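(* Let $n \geq 2$ be a natural number, and let $a_1, a_2, \dots, a_n > 0$ and $b_1, b_2, \dots, b_n > 0$ be two finite sequences of positive real numbers of the same length $n$. For all real numbers $p \neq 0$ there is the following strict inequality: $$\frac{\|\vec{a}\|_p}{\|\vec{b}\|_p} = \sqrt[p]{\frac{a_1^p + a_2^p + a_3^p + \dots + a_n^p}{b_1^p + b_2^p + b_3^p + \dots + b_n^p}} \; < \; \sum_{k=1}^{n} \frac{a_k}{b_k}.$$ The inequality remains valid also for the limits $p = -\infty$, $p = \infty$, and $p = 0$. Further, the inequality is sharp, i.e. in this generality it can not be improved. Further, for $n = 1$ we have a trivial equality.
   Context: For an $n$-tuple $\vec{a} = (a_1, \dots, a_n)$ of positive real numbers and a real number $p \neq 0$ (possibly negative), the Hölder functional is defined by $\|\vec{a}\|_p := \sqrt[p]{a_1^p + a_2^p + \dots + a_n^p} = \left(a_1^p + a_2^p + \dots + a_n^p\right)^{1/p}$. Here $\vec{a} = (a_1,\dots,a_n)$ and $\vec{b} = (b_1,\dots,b_n)$; no ordering of the entries is assumed. The cases $p = -\infty$, $p = \infty$ and $p = 0$ refer to the limits of the quotient $\|\vec{a}\|_p / \|\vec{b}\|_p$ as $p \to -\infty$, $p \to +\infty$ and $p \to 0$, respectively. *)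

theory Defs
  imports Complex_Main
begin

text \<open>An \<open>n\<close>-tuple is given by the values of a function on \<open>{1..n}\<close>;
  values outside \<open>{1..n}\<close> are irrelevant.\<close>

definition pos_tuple :: "nat \<Rightarrow> (nat \<Rightarrow> real) \<Rightarrow> bool" where
  "pos_tuple n a \<longleftrightarrow> (\<forall>k\<in>{1..n}. 0 < a k)"

text \<open>Only meaningful for \<open>p \<noteq> 0\<close> (at \<open>p = 0\<close> the exponent is \<open>1 / 0 = 0\<close>).
  The exponents \<open>p = -\<infinity>, \<infinity>, 0\<close> are treated as limits of the quotient as a function
  of \<open>p\<close>, along the filters \<open>at_bot\<close>, \<open>at_top\<close> and the punctured two-sided \<open>at 0\<close>.\<close>

definition holder_functional :: "nat \<Rightarrow> real \<Rightarrow> (nat \<Rightarrow> real) \<Rightarrow> real" where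
  "holder_functional n p a = (\<Sum>k = 1..n. a k powr p) powr (1 / p)"

definition holder_quotient ::
    "nat \<Rightarrow> (nat \<Rightarrow> real) \<Rightarrow> (nat \<Rightarrow> real) \<Rightarrow> real \<Rightarrow> real" where
  "holder_quotient n a b p = holder_functional n p a / holder_functional n p b"

end

theory Submission
  imports Defs
begin

text \<open>If \<open>M\<close> is the largest of the ratios \<open>a k / b k\<close>, then \<open>a k \<le> M * b k\<close> for all \<open>k\<close>, so the
  quotient is at most \<open>M\<close> by monotonicity of the functional. This bound does not depend on \<open>p\<close>, so it
  passes to the limits, and for \<open>n \<ge> 2\<close> the number \<open>M\<close> is strictly smaller than the sum of the
  ratios. Negative exponents reduce to positive ones by exchanging \<open>a\<close> and \<open>b\<close> and inverting all
  entries, which preserves the ratios. The inequality is sharp for \<open>a = (1, e\<^sup>2, \<dots>, e\<^sup>2)\<close> and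
  \<open>b = (1, e, \<dots>, e)\<close> with \<open>e \<rightarrow> 0\<close>.\<close>

section \<open>Positivity, and the symmetry between exponents \<open>p\<close> and
  \<open>- p\<close>\<close>

lemma pos_tupleD: "pos_tuple n a \<Longrightarrow> k \<in> {1..n} \<Longrightarrow> 0 < a k"
  by (auto simp: pos_tuple_def)

lemma pos_tuple_inverse: "pos_tuple n a \<Longrightarrow> pos_tuple n (\<lambda>k. inverse (a k))"
  by (auto simp: pos_tuple_def)

lemma sum_powr_pos:
  assumes "pos_tuple n a" "n \<ge> 1"
  shows "0 < (\<Sum>k = 1..n. a k powr p)"
  using assms by (intro sum_pos) (force simp: pos_tuple_def)+

lemma holder_functional_pos:
  assumes "pos_tuple n a" "n \<ge> 1"
  shows "0 < holder_functional n p a"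
  using sum_powr_pos[OF assms, of p] by (simp add: holder_functional_def)

lemma holder_functional_minus:
  assumes "pos_tuple n a"
  shows "holder_functional n (- p) a = inverse (holder_functional n p (\<lambda>k. inverse (a k)))"
proof -
  have "(\<Sum>k = 1..n. a k powr - p) = (\<Sum>k = 1..n. inverse (a k) powr p)"
    using assms by (intro sum.cong) (auto simp: pos_tuple_def powr_minus inverse_powr)
  then show ?thesis
    by (simp add: holder_functional_def powr_minus)
qed

text \<open>Negating the exponent turns each functional into a reciprocal, so numerator and
  denominator trade places. Since \<open>inverse (b k) / inverse (a k) = a k / b k\<close>, both
  upper bounds and extremal examples carry over from positive to negative exponents.\<close>

lemma holder_quotient_minus:
  assumes "pos_tuple n a" "pos_tuple n b"
  shows "holder_quotient n a b (- p)
    = holder_quotient n (\<lambda>k. inverse (b k)) (\<lambda>k. inverse (a k)) p"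
  using assms by (simp add: holder_quotient_def holder_functional_minus field_simps)

lemma holder_quotient_eq_powr:
  assumes "pos_tuple n a" "pos_tuple n b"
  shows "holder_quotient n a b p
    = ((\<Sum>k = 1..n. a k powr p) / (\<Sum>k = 1..n. b k powr p)) powr (1 / p)"
  by (simp add: holder_quotient_def holder_functional_def powr_divide sum_nonneg)

section \<open>Monotonicity, homogeneity and the bound by the largest ratio\<close>

lemma holder_functional_mono:
  assumes "pos_tuple n a" "\<And>k. k \<in> {1..n} \<Longrightarrow> a k \<le> b k" "p > 0"
  shows "holder_functional n p a \<le> holder_functional n p b"
  unfolding holder_functional_def using assms
  by (intro powr_mono2 sum_mono) (auto simp: pos_tuple_def less_imp_le intro!: sum_nonneg)

lemma holder_functional_scale:
  assumes "M > 0" "p \<noteq> 0" "pos_tuple n b"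
  shows "holder_functional n p (\<lambda>k. M * b k) = M * holder_functional n p b"
proof -
  have "(\<Sum>k = 1..n. (M * b k) powr p) = M powr p * (\<Sum>k = 1..n. b k powr p)"
    using assms by (simp add: sum_distrib_left powr_mult pos_tuple_def less_imp_le)
  then show ?thesis
    using assms by (simp add: holder_functional_def powr_mult sum_nonneg powr_powr)
qed

lemma holder_quotient_le_pos:
  assumes "pos_tuple n a" "pos_tuple n b" "n \<ge> 1" "M > 0"
    and "\<And>k. k \<in> {1..n} \<Longrightarrow> a k \<le> M * b k" "p > 0"
  shows "holder_quotient n a b p \<le> M"
proof -
  have "holder_functional n p a \<le> M * holder_functional n p b"
    using holder_functional_mono[of n a "\<lambda>k. M * b k" p] holder_functional_scale[of M p n b] assms
    by simp
  then show ?thesis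
    using holder_functional_pos[OF assms(2,3), of p] by (simp add: holder_quotient_def field_simps)
qed

lemma holder_quotient_le:
  assumes a: "pos_tuple n a" and b: "pos_tuple n b" and "n \<ge> 1" "M > 0"
    and le: "\<And>k. k \<in> {1..n} \<Longrightarrow> a k \<le> M * b k" and "p \<noteq> 0"
  shows "holder_quotient n a b p \<le> M"
proof (cases "p > 0")
  case True
  then show ?thesis using holder_quotient_le_pos assms by blast
next
  case False
  \<comment> \<open>The hypothesis \<open>a k \<le> M * b k\<close> survives the exchange with the
    same \<open>M\<close>: dividing it by \<open>a k * b k\<close> gives
    \<open>inverse (b k) \<le> M * inverse (a k)\<close>.\<close>
  have "holder_quotient n (\<lambda>k. inverse (b k)) (\<lambda>k. inverse (a k)) (- p) \<le> M"
  proof (rule holder_quotient_le_pos)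
    fix k assume "k \<in> {1..n}"
    then show "inverse (b k) \<le> M * inverse (a k)"
      using le[of k] pos_tupleD[OF a, of k] pos_tupleD[OF b, of k] by (simp add: field_simps)
  qed (use assms False in \<open>auto intro: pos_tuple_inverse\<close>)
  then show ?thesis
    using holder_quotient_minus[OF a b, of "- p"] by simp
qed

text \<open>Passing to a limit preserves only weak inequalities, so the gap below the sum must be
  secured beforehand by an \<open>M\<close> that does not depend on \<open>p\<close>.\<close>

lemma ratio_bound_less_sum:
  assumes a: "pos_tuple n a" and b: "pos_tuple n b" and n: "n \<ge> 2"
  obtains M where "M > 0" "\<And>k. k \<in> {1..n} \<Longrightarrow> a k \<le> M * b k" "M < (\<Sum>k = 1..n. a k / b k)"
proof -
  define r where "r k = a k / b k" for k
  have r: "r k > 0" if "k \<in> {1..n}" for k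
    using that a b by (simp add: r_def pos_tuple_def)
  define M where "M = Max (r ` {1..n})"
  have "M \<in> r ` {1..n}"
    unfolding M_def using n by (intro Max_in) auto
  then obtain j where j: "j \<in> {1..n}" "M = r j" by auto
  show ?thesis
  proof (rule that[of M])
    show "M > 0" using j r by simp
    show "a k \<le> M * b k" if "k \<in> {1..n}" for k
    proof -
      have "r k \<le> M" using that by (simp add: M_def)
      then show ?thesis using pos_tupleD[OF b that] by (simp add: r_def field_simps)
    qed
    \<comment> \<open>Here \<open>n \<ge> 2\<close> enters: some index other than \<open>j\<close>
      remains, and its positive ratio makes the inequality strict.\<close>
    have "card ({1..n} - {j}) > 0" using j n by simp
    then have "(\<Sum>k\<in>{1..n} - {j}. r k) > 0"
      using r by (intro sum_pos) (auto simp: card_gt_0_iff)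
    then show "M < (\<Sum>k = 1..n. a k / b k)"
      using j sum.remove[of "{1..n}" j r] by (simp add: r_def)
  qed
qed

section \<open>Existence of the limits at both infinities and at 0\<close>

lemma holder_functional_tendsto_Max:
  assumes a: "pos_tuple n a" and n: "n \<ge> 1"
  shows "((\<lambda>p. holder_functional n p a) \<longlongrightarrow> Max (a ` {1..n})) at_top"
proof -
  define M where "M = Max (a ` {1..n})"
  have "M \<in> a ` {1..n}"
    unfolding M_def using n by (intro Max_in) auto
  then obtain j where j: "j \<in> {1..n}" "M = a j" by auto
  have M: "M > 0" using j a by (simp add: pos_tuple_def)
  \<comment> \<open>Lower bound: keep only the largest summand.\<close>
  have lower: "M \<le> holder_functional n p a" if "p > 0" for p
  proof -
    have "M = (a j powr p) powr (1 / p)"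
      using M j that by (simp add: powr_powr)
    also have "\<dots> \<le> holder_functional n p a"
      unfolding holder_functional_def using that j
      by (intro powr_mono2 member_le_sum) auto
    finally show ?thesis .
  qed
  \<comment> \<open>Upper bound: raise every entry to \<open>M\<close>. The constant tuple is
    written \<open>M * 1\<close> so that homogeneity applies; the constant tuple 1 contributes
    \<open>n powr (1 / p)\<close>, which tends to 1.\<close>
  have upper: "holder_functional n p a \<le> M * real n powr (1 / p)" if "p > 0" for p
  proof -
    have "holder_functional n p a \<le> holder_functional n p (\<lambda>k. M * 1)"
      using a that by (intro holder_functional_mono) (auto simp: M_def)
    also have "\<dots> = M * holder_functional n p (\<lambda>k. 1)"
      using M that by (intro holder_functional_scale) (auto simp: pos_tuple_def)
    finally show ?thesis by (simp add: holder_functional_def)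
  qed
  have "((\<lambda>p. 1 / p) \<longlongrightarrow> (0::real)) at_top"
    by (rule tendsto_divide_0[OF tendsto_const filterlim_at_top_imp_at_infinity[OF filterlim_ident]])
  then have "((\<lambda>p. M * real n powr (1 / p)) \<longlongrightarrow> M * real n powr 0) at_top"
    using n by (intro tendsto_intros) auto
  then have lim: "((\<lambda>p. M * real n powr (1 / p)) \<longlongrightarrow> M) at_top"
    using n by simp
  show ?thesis
    unfolding M_def[symmetric]
  proof (rule tendsto_sandwich[OF _ _ tendsto_const lim])
    show "\<forall>\<^sub>F p in at_top. M \<le> holder_functional n p a"
      using eventually_gt_at_top[of 0] by eventually_elim (rule lower)
    show "\<forall>\<^sub>F p in at_top. holder_functional n p a \<le> M * real n powr (1 / p)"
      using eventually_gt_at_top[of 0] by eventually_elim (rule upper)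
  qed
qed

lemma holder_quotient_tendsto_at_top:
  assumes "pos_tuple n a" "pos_tuple n b" "n \<ge> 1"
  shows "(holder_quotient n a b \<longlongrightarrow> Max (a ` {1..n}) / Max (b ` {1..n})) at_top"
proof -
  have "Max (b ` {1..n}) \<in> b ` {1..n}"
    using assms(3) by (intro Max_in) auto
  then have "Max (b ` {1..n}) \<noteq> 0"
    using assms(2) by (force simp: pos_tuple_def)
  then show ?thesis
    unfolding holder_quotient_def[abs_def] using assms
    by (intro tendsto_divide holder_functional_tendsto_Max)
qed

lemma holder_quotient_tendsto_at_bot_iff:
  assumes "pos_tuple n a" "pos_tuple n b"
  shows "(holder_quotient n a b \<longlongrightarrow> L) at_bot \<longleftrightarrow>
    (holder_quotient n (\<lambda>k. inverse (b k)) (\<lambda>k. inverse (a k)) \<longlongrightarrow> L) at_top"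
  using holder_quotient_minus[OF assms] by (simp add: filterlim_at_bot_mirror)

text \<open>Each \<open>a k powr p\<close> has slope \<open>ln (a k)\<close> at 0, and the sum takes
  the value \<open>n\<close> there, so the logarithmic derivative is the mean of the
  logarithms.\<close>

lemma ln_sum_powr_DERIV_0:
  assumes "pos_tuple n a" "n \<ge> 1"
  shows "((\<lambda>p. ln (\<Sum>k = 1..n. a k powr p)) has_real_derivative (\<Sum>k = 1..n. ln (a k)) / n) (at 0)"
proof -
  have "((\<lambda>p. a k powr p) has_real_derivative ln (a k)) (at 0)" if "k \<in> {1..n}" for k
    using pos_tupleD[OF assms(1) that] by (auto intro!: derivative_eq_intros)
  then have "((\<lambda>p. \<Sum>k = 1..n. a k powr p) has_real_derivative (\<Sum>k = 1..n. ln (a k))) (at 0)"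
    by (rule DERIV_sum)
  \<comment> \<open>Positivity matters here: \<open>0 powr 0\<close> would be 0.\<close>
  moreover have eq: "(\<Sum>k = 1..n. a k powr 0) = real n"
  proof -
    have "(\<Sum>k = 1..n. a k powr 0) = (\<Sum>k = 1..n. 1)"
      using assms by (intro sum.cong) (force simp: pos_tuple_def)+
    then show ?thesis by simp
  qed
  ultimately show ?thesis
    using DERIV_chain2[OF DERIV_ln_divide, of "\<lambda>p. \<Sum>k = 1..n. a k powr p" 0] assms(2)
    by fastforce
qed

text \<open>For \<open>p \<noteq> 0\<close> the logarithm of the quotient is the difference quotient at \<open>0\<close> of
  \<open>ln (\<Sum>k. a k powr p) - ln (\<Sum>k. b k powr p)\<close>, which vanishes at \<open>p = 0\<close>.\<close>
lemma holder_quotient_tendsto_at_0: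
  assumes a: "pos_tuple n a" and b: "pos_tuple n b" and n: "n \<ge> 1"
  shows "(holder_quotient n a b \<longlongrightarrow>
    exp ((\<Sum>k = 1..n. ln (a k)) / n - (\<Sum>k = 1..n. ln (b k)) / n)) (at 0)"
    (is "(_ \<longlongrightarrow> exp ?D) _")
proof -
  define f where "f p = ln (\<Sum>k = 1..n. a k powr p) - ln (\<Sum>k = 1..n. b k powr p)" for p
  have "(f has_real_derivative ?D) (at 0)"
    unfolding f_def using assms by (intro DERIV_diff ln_sum_powr_DERIV_0)
  moreover have "f 0 = 0"
  proof -
    have "(\<Sum>k = 1..n. a k powr 0) = (\<Sum>k = 1..n. b k powr 0)"
      using a b by (intro sum.cong) (force simp: pos_tuple_def)+
    then show ?thesis by (simp add: f_def)
  qed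
  ultimately have "((\<lambda>p. f p / p) \<longlongrightarrow> ?D) (at 0)"
    by (simp add: DERIV_def)
  \<comment> \<open>The value \<open>exp ?D\<close> is the quotient of the geometric means of
    \<open>a\<close> and \<open>b\<close>.\<close>
  then have "((\<lambda>p. exp (f p / p)) \<longlongrightarrow> exp ?D) (at 0)"
    by (rule tendsto_exp)
  moreover have "\<forall>\<^sub>F p in at 0. exp (f p / p) = holder_quotient n a b p"
  proof (rule eventually_at_filter[THEN iffD2], rule always_eventually, intro allI impI)
    fix p :: real
    show "exp (f p / p) = holder_quotient n a b p"
      using sum_powr_pos[OF a n, of p] sum_powr_pos[OF b n, of p] holder_quotient_eq_powr[OF a b, of p]
      by (simp add: f_def powr_def ln_div)
  qed
  ultimately show ?thesis
    by (rule Lim_transform_eventually)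
qed

lemma holder_quotient_limit_ex:
  assumes "pos_tuple n a" "pos_tuple n b" "n \<ge> 1" "F \<in> {at_bot, at_top, at (0::real)}"
  shows "\<exists>L. (holder_quotient n a b \<longlongrightarrow> L) F"
  using assms holder_quotient_tendsto_at_top[of n a b] holder_quotient_tendsto_at_0[of n a b]
    holder_quotient_tendsto_at_bot_iff[of n a b]
    holder_quotient_tendsto_at_top[of n "\<lambda>k. inverse (b k)" "\<lambda>k. inverse (a k)"]
    pos_tuple_inverse[of n a] pos_tuple_inverse[of n b]
  by blast

section \<open>The strict inequality for the limits\<close>

lemma eventually_nonzero:
  assumes "F \<in> {at_bot, at_top, at (0::real)}"
  shows "\<forall>\<^sub>F p in F. p \<noteq> 0"
  using assms eventually_neq_at_within[of "0::real" 0 UNIV]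
    eventually_gt_at_top[of "0::real"] eventually_gt_at_bot[of "0::real"]
  by (auto elim: eventually_mono)

lemma holder_quotient_limit_less:
  assumes a: "pos_tuple n a" and b: "pos_tuple n b" and n: "n \<ge> 2"
    and F: "F \<in> {at_bot, at_top, at (0::real)}"
  shows "\<exists>L. (holder_quotient n a b \<longlongrightarrow> L) F \<and> L < (\<Sum>k = 1..n. a k / b k)"
proof -
  obtain M where M: "M > 0" "\<And>k. k \<in> {1..n} \<Longrightarrow> a k \<le> M * b k" "M < (\<Sum>k = 1..n. a k / b k)"
    using ratio_bound_less_sum[OF a b n] by blast
  obtain L where L: "(holder_quotient n a b \<longlongrightarrow> L) F"
    using holder_quotient_limit_ex[OF a b _ F] n by auto
  have "\<forall>\<^sub>F p in F. holder_quotient n a b p \<le> M"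
    using eventually_nonzero[OF F]
    by eventually_elim (use holder_quotient_le[OF a b _ M(1,2)] n in auto)
  \<comment> \<open>A limit inherits an eventual upper bound only along a nontrivial filter.\<close>
  moreover have "F \<noteq> bot"
    using F by (elim insertE emptyE) simp_all
  ultimately have "L \<le> M"
    using L tendsto_upperbound by blast
  then show ?thesis using L M(3) by auto
qed

section \<open>Sharpness\<close>

definition spike :: "real \<Rightarrow> nat \<Rightarrow> real" where
  "spike e k = (if k = 1 then 1 else e)"

lemma pos_tuple_spike: "e > 0 \<Longrightarrow> pos_tuple n (spike e)"
  by (simp add: pos_tuple_def spike_def)

text \<open>A general \<open>g\<close> covers both the power sums and the sum of the ratios.\<close>

lemma sum_spike:
  assumes "n \<ge> 1"
  shows "(\<Sum>k = 1..n. g (spike e k)) = g 1 + (real n - 1) * g e"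
proof -
  have "(\<Sum>k = 1..n. g (spike e k)) = g 1 + (\<Sum>k = Suc 1..n. g (spike e k))"
    using assms by (simp add: sum.atLeast_Suc_atMost spike_def)
  also have "(\<Sum>k = Suc 1..n. g (spike e k)) = (\<Sum>k = Suc 1..n. g e)"
    by (intro sum.cong) (auto simp: spike_def)
  finally show ?thesis using assms by (simp add: of_nat_diff)
qed

lemma sum_spike_ratio:
  assumes "n \<ge> 1" "e > 0"
  shows "(\<Sum>k = 1..n. spike (e\<^sup>2) k / spike e k) = 1 + (real n - 1) * e"
proof -
  \<comment> \<open>The square is chosen so that the ratios again form a spike: all but the first
    equal \<open>e\<close> and vanish as \<open>e\<close> tends to 0.\<close>
  have "(\<Sum>k = 1..n. spike (e\<^sup>2) k / spike e k) = (\<Sum>k = 1..n. spike e k)"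
    using assms by (intro sum.cong) (auto simp: spike_def power2_eq_square)
  then show ?thesis using sum_spike[OF assms(1), of "\<lambda>x. x" e] by simp
qed

lemma sum_spike_ratio_tendsto:
  assumes "n \<ge> 1"
  shows "((\<lambda>e. c * (\<Sum>k = 1..n. spike (e\<^sup>2) k / spike e k)) \<longlongrightarrow> c) (at_right 0)"
proof -
  have "((\<lambda>e. c * (1 + (real n - 1) * e)) \<longlongrightarrow> c * (1 + (real n - 1) * 0)) (at_right 0)"
    by (intro tendsto_intros)
  moreover have "\<forall>\<^sub>F e in at_right 0.
      c * (1 + (real n - 1) * e) = c * (\<Sum>k = 1..n. spike (e\<^sup>2) k / spike e k)"
    using eventually_at_right_less[of "0::real"]
    by eventually_elim (use sum_spike_ratio[OF assms] in simp)
  ultimately show ?thesis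
    by (simp add: Lim_transform_eventually)
qed

text \<open>For positive \<open>p\<close> the small entries contribute nothing in the limit, leaving
  only the entry 1. The function \<open>f\<close> will be \<open>e\<close> for the denominator and
  its square for the numerator.\<close>

lemma holder_functional_spike_tendsto:
  assumes "n \<ge> 1" "p > 0" "(f \<longlongrightarrow> 0) (at_right 0)" "\<forall>\<^sub>F e in at_right 0. f e \<ge> 0"
  shows "((\<lambda>e::real. holder_functional n p (spike (f e))) \<longlongrightarrow> 1) (at_right 0)"
proof -
  \<comment> \<open>The base tends to 0, where continuity of \<open>powr\<close> needs a nonnegative
    base and a positive exponent.\<close>
  have lim: "((\<lambda>e. f e powr p) \<longlongrightarrow> 0 powr p) (at_right 0)"
    using assms(2-4) by (intro tendsto_powr2 tendsto_const) auto
  have "((\<lambda>e. (1 + (real n - 1) * f e powr p) powr (1 / p))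
      \<longlongrightarrow> (1 + (real n - 1) * 0 powr p) powr (1 / p)) (at_right 0)"
    using assms(2) by (intro tendsto_powr tendsto_add tendsto_mult tendsto_const lim) auto
  then show ?thesis
    using assms(2) sum_spike[OF assms(1), of "\<lambda>x. x powr p"] by (simp add: holder_functional_def)
qed

text \<open>Along the spikes the quotient tends to 1, while \<open>c\<close> times the sum of the
  ratios tends to \<open>c < 1\<close>; hence any sufficiently small \<open>e > 0\<close> gives an
  example.\<close>

lemma holder_quotient_sharp_pos:
  assumes "n \<ge> 1" "p > 0" "c < 1"
  shows "\<exists>a b. pos_tuple n a \<and> pos_tuple n b \<and>
    c * (\<Sum>k = 1..n. a k / b k) < holder_quotient n a b p"
proof -
  have 1: "((\<lambda>e::real. e) \<longlongrightarrow> 0) (at_right 0)" by (rule tendsto_ident_at)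
  have 2: "((\<lambda>e::real. e\<^sup>2) \<longlongrightarrow> 0) (at_right 0)" using tendsto_power[OF 1, of 2] by simp
  have "((\<lambda>e. holder_quotient n (spike (e\<^sup>2)) (spike e) p) \<longlongrightarrow> 1 / 1) (at_right 0)"
    unfolding holder_quotient_def using assms 1 2 eventually_at_right_less[of "0::real"]
    by (intro tendsto_divide holder_functional_spike_tendsto) (auto elim: eventually_mono)
  then have "\<forall>\<^sub>F e in at_right 0. holder_quotient n (spike (e\<^sup>2)) (spike e) p
      - c * (\<Sum>k = 1..n. spike (e\<^sup>2) k / spike e k) > 0"
    using assms(3)
    by (intro order_tendstoD(1)[OF tendsto_diff[OF _ sum_spike_ratio_tendsto[OF assms(1)]]]) auto
  then have "\<forall>\<^sub>F e in at_right (0::real). e > 0 \<and> holder_quotient n (spike (e\<^sup>2)) (spike e) p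
      - c * (\<Sum>k = 1..n. spike (e\<^sup>2) k / spike e k) > 0"
    using eventually_at_right_less by eventually_elim auto
  then obtain e :: real where e: "e > 0" "holder_quotient n (spike (e\<^sup>2)) (spike e) p
      - c * (\<Sum>k = 1..n. spike (e\<^sup>2) k / spike e k) > 0"
    using eventually_happens trivial_limit_at_right_real by blast
  have "pos_tuple n (spike (e\<^sup>2))" "pos_tuple n (spike e)"
    using e(1) by (auto intro: pos_tuple_spike)
  with e(2) show ?thesis by (intro exI[of _ "spike (e\<^sup>2)"] exI[of _ "spike e"]) simp
qed

lemma Max_spike:
  assumes "n \<ge> 1" "e \<le> 1"
  shows "Max (spike e ` {1..n}) = 1"
  using assms by (intro Max_eqI) (auto simp: spike_def image_iff)

text \<open>For spikes with \<open>0 < e < 1\<close> both maxima are 1, so the limit of the quotient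
  is exactly 1 and \<open>e\<close> only has to push \<open>c\<close> times the sum below 1.\<close>

lemma holder_quotient_sharp_at_top:
  assumes "n \<ge> 1" "c < 1"
  shows "\<exists>a b L. pos_tuple n a \<and> pos_tuple n b \<and> (holder_quotient n a b \<longlongrightarrow> L) at_top \<and>
    c * (\<Sum>k = 1..n. a k / b k) < L"
proof -
  have "\<forall>\<^sub>F e in at_right 0. c * (\<Sum>k = 1..n. spike (e\<^sup>2) k / spike e k) < 1"
    by (rule order_tendstoD(2)[OF sum_spike_ratio_tendsto[OF assms(1)] assms(2)])
  then have "\<forall>\<^sub>F e in at_right (0::real). 0 < e \<and> e < 1 \<and>
      c * (\<Sum>k = 1..n. spike (e\<^sup>2) k / spike e k) < 1"
    using eventually_at_right_less eventually_at_right_real[OF zero_less_one]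
    by eventually_elim auto
  then obtain e :: real where e: "0 < e" "e < 1"
      "c * (\<Sum>k = 1..n. spike (e\<^sup>2) k / spike e k) < 1"
    using eventually_happens trivial_limit_at_right_real by blast
  have "e\<^sup>2 \<le> 1" using e by (simp add: power_le_one)
  have pos: "pos_tuple n (spike (e\<^sup>2))" "pos_tuple n (spike e)"
    using e(1) by (auto intro: pos_tuple_spike)
  then have "(holder_quotient n (spike (e\<^sup>2)) (spike e) \<longlongrightarrow> 1) at_top"
    using holder_quotient_tendsto_at_top[OF pos assms(1)] e \<open>e\<^sup>2 \<le> 1\<close> assms(1)
    by (simp only: Max_spike less_imp_le div_by_1)
  with e(3) pos show ?thesis by blast
qed

lemma sum_inverse_ratio:
  "(\<Sum>k = 1..n. inverse (b k) / inverse (a k)) = (\<Sum>k = 1..n. a k / b k :: real)"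
  by (simp add: field_simps)

lemma holder_quotient_sharp:
  assumes "n \<ge> 1" "p \<noteq> 0" "c < 1"
  shows "\<exists>a b. pos_tuple n a \<and> pos_tuple n b \<and>
    c * (\<Sum>k = 1..n. a k / b k) < holder_quotient n a b p"
proof (cases "p > 0")
  case True
  then show ?thesis using holder_quotient_sharp_pos assms by blast
next
  case False
  \<comment> \<open>An example for the positive exponent \<open>- p\<close> becomes one for
    \<open>p\<close> after inverting and exchanging the tuples.\<close>
  then obtain a b where ab: "pos_tuple n a" "pos_tuple n b"
      "c * (\<Sum>k = 1..n. a k / b k) < holder_quotient n a b (- p)"
    using holder_quotient_sharp_pos[of n "- p" c] assms by auto
  then have "c * (\<Sum>k = 1..n. inverse (b k) / inverse (a k))
      < holder_quotient n (\<lambda>k. inverse (b k)) (\<lambda>k. inverse (a k)) p"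
    by (simp only: sum_inverse_ratio holder_quotient_minus)
  with ab(1,2)[THEN pos_tuple_inverse] show ?thesis
    by (intro exI[of _ "\<lambda>k. inverse (b k)"] exI[of _ "\<lambda>k. inverse (a k)"] conjI)
qed

lemma holder_quotient_sharp_at_bot:
  assumes "n \<ge> 1" "c < 1"
  shows "\<exists>a b L. pos_tuple n a \<and> pos_tuple n b \<and> (holder_quotient n a b \<longlongrightarrow> L) at_bot \<and>
    c * (\<Sum>k = 1..n. a k / b k) < L"
proof -
  obtain a b L where ab: "pos_tuple n a" "pos_tuple n b" "(holder_quotient n a b \<longlongrightarrow> L) at_top"
      "c * (\<Sum>k = 1..n. a k / b k) < L"
    using holder_quotient_sharp_at_top[OF assms] by blast
  note pos = ab(1,2)[THEN pos_tuple_inverse]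
  \<comment> \<open>The equivalence is applied to the inverted and exchanged tuples; double inverses
    cancel, so its \<open>at_top\<close> side is the known limit for \<open>a\<close> and
    \<open>b\<close>.\<close>
  have "(holder_quotient n (\<lambda>k. inverse (b k)) (\<lambda>k. inverse (a k)) \<longlongrightarrow> L) at_bot"
    using holder_quotient_tendsto_at_bot_iff[OF pos(2,1)] ab(3) by simp
  moreover have "c * (\<Sum>k = 1..n. inverse (b k) / inverse (a k)) < L"
    using ab(4) by (simp only: sum_inverse_ratio)
  ultimately show ?thesis using pos by blast
qed

section \<open>The strict inequality for nonzero exponents, and the case of length one\<close>

lemma holder_quotient_less:
  assumes "pos_tuple n a" "pos_tuple n b" "n \<ge> 2" "p \<noteq> 0"
  shows "holder_quotient n a b p < (\<Sum>k = 1..n. a k / b k)"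
proof -
  obtain M where "M > 0" "\<And>k. k \<in> {1..n} \<Longrightarrow> a k \<le> M * b k" "M < (\<Sum>k = 1..n. a k / b k)"
    using ratio_bound_less_sum[OF assms(1-3)] by blast
  then show ?thesis
    using holder_quotient_le[OF assms(1,2), of M p] assms(3,4) by auto
qed

lemma holder_quotient_1:
  assumes "pos_tuple 1 a" "pos_tuple 1 b" "p \<noteq> 0"
  shows "holder_quotient 1 a b p = (\<Sum>k = 1..1. a k / b k)"
  using assms by (simp add: holder_quotient_def holder_functional_def powr_powr pos_tuple_def)

text \<open>For length one the quotient is constant away from \<open>p = 0\<close>, and each of the
  three filters eventually avoids 0.\<close>

lemma holder_quotient_1_tendsto:
  assumes "pos_tuple 1 a" "pos_tuple 1 b" "F \<in> {at_bot, at_top, at (0::real)}"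
  shows "(holder_quotient 1 a b \<longlongrightarrow> (\<Sum>k = 1..1. a k / b k)) F"
proof (rule Lim_transform_eventually[OF tendsto_const])
  show "\<forall>\<^sub>F p in F. (\<Sum>k = 1..1. a k / b k) = holder_quotient 1 a b p"
    using eventually_nonzero[OF assms(3)]
    by eventually_elim (rule holder_quotient_1[OF assms(1,2), symmetric])
qed

theorem theorem2:
  shows
    "(\<forall>n\<ge>2. \<forall>a b. \<forall>p::real. pos_tuple n a \<longrightarrow> pos_tuple n b \<longrightarrow> p \<noteq> 0 \<longrightarrow>
        holder_quotient n a b p
          = ((\<Sum>k = 1..n. a k powr p) / (\<Sum>k = 1..n. b k powr p)) powr (1 / p)
        \<and> holder_quotient n a b p < (\<Sum>k = 1..n. a k / b k))
    \<and>
     (\<forall>n\<ge>2. \<forall>a b. pos_tuple n a \<longrightarrow> pos_tuple n b \<longrightarrow>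
        (\<forall>F\<in>{at_bot, at_top, at (0::real)}.
          \<exists>L. (holder_quotient n a b \<longlongrightarrow> L) F \<and> L < (\<Sum>k = 1..n. a k / b k)))
    \<and>
     (\<forall>n\<ge>2. \<forall>p::real. p \<noteq> 0 \<longrightarrow> (\<forall>c<1.
        \<exists>a b. pos_tuple n a \<and> pos_tuple n b \<and>
          c * (\<Sum>k = 1..n. a k / b k) < holder_quotient n a b p))
    \<and>
     (\<forall>n\<ge>2. \<forall>F\<in>{at_bot, at_top :: real filter}. \<forall>c<1.
        \<exists>a b L. pos_tuple n a \<and> pos_tuple n b \<and> (holder_quotient n a b \<longlongrightarrow> L) F \<and>
          c * (\<Sum>k = 1..n. a k / b k) < L)
    \<and>
     (\<forall>a b. pos_tuple 1 a \<longrightarrow> pos_tuple 1 b \<longrightarrow>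
        (\<forall>p::real. p \<noteq> 0 \<longrightarrow>
          holder_quotient 1 a b p
            = ((\<Sum>k = 1..1. a k powr p) / (\<Sum>k = 1..1. b k powr p)) powr (1 / p)
          \<and> holder_quotient 1 a b p = (\<Sum>k = 1..1. a k / b k)) \<and>
        (\<forall>F\<in>{at_bot, at_top, at (0::real)}.
          (holder_quotient 1 a b \<longlongrightarrow> (\<Sum>k = 1..1. a k / b k)) F))"
proof (intro conjI)
  show "\<forall>n\<ge>2. \<forall>a b. \<forall>p::real. pos_tuple n a \<longrightarrow> pos_tuple n b \<longrightarrow> p \<noteq> 0 \<longrightarrow>
        holder_quotient n a b p
          = ((\<Sum>k = 1..n. a k powr p) / (\<Sum>k = 1..n. b k powr p)) powr (1 / p)
        \<and> holder_quotient n a b p < (\<Sum>k = 1..n. a k / b k)"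
    using holder_quotient_eq_powr holder_quotient_less by blast
  show "\<forall>n\<ge>2. \<forall>a b. pos_tuple n a \<longrightarrow> pos_tuple n b \<longrightarrow>
        (\<forall>F\<in>{at_bot, at_top, at (0::real)}.
          \<exists>L. (holder_quotient n a b \<longlongrightarrow> L) F \<and> L < (\<Sum>k = 1..n. a k / b k))"
    using holder_quotient_limit_less by blast
  show "\<forall>n\<ge>2. \<forall>p::real. p \<noteq> 0 \<longrightarrow> (\<forall>c<1.
        \<exists>a b. pos_tuple n a \<and> pos_tuple n b \<and>
          c * (\<Sum>k = 1..n. a k / b k) < holder_quotient n a b p)"
    by (intro allI impI holder_quotient_sharp) auto
  \<comment> \<open>The limit at 0 is absent from this sharpness claim: there the quotient tends to
    a quotient of geometric means, which by the AM-GM inequality is at most \<open>1 / n\<close>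
    times the sum of the ratios.\<close>
  show "\<forall>n\<ge>2. \<forall>F\<in>{at_bot, at_top :: real filter}. \<forall>c<1.
        \<exists>a b L. pos_tuple n a \<and> pos_tuple n b \<and> (holder_quotient n a b \<longlongrightarrow> L) F \<and>
          c * (\<Sum>k = 1..n. a k / b k) < L"
  proof (intro allI impI ballI)
    fix n :: nat and F :: "real filter" and c :: real
    assume "n \<ge> 2" "F \<in> {at_bot, at_top}" "c < 1"
    then show "\<exists>a b L. pos_tuple n a \<and> pos_tuple n b \<and> (holder_quotient n a b \<longlongrightarrow> L) F \<and>
          c * (\<Sum>k = 1..n. a k / b k) < L"
      using holder_quotient_sharp_at_bot[of n c] holder_quotient_sharp_at_top[of n c] by auto
  qed
  show "\<forall>a b. pos_tuple 1 a \<longrightarrow> pos_tuple 1 b \<longrightarrow>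
        (\<forall>p::real. p \<noteq> 0 \<longrightarrow>
          holder_quotient 1 a b p
            = ((\<Sum>k = 1..1. a k powr p) / (\<Sum>k = 1..1. b k powr p)) powr (1 / p)
          \<and> holder_quotient 1 a b p = (\<Sum>k = 1..1. a k / b k)) \<and>
        (\<forall>F\<in>{at_bot, at_top, at (0::real)}.
          (holder_quotient 1 a b \<longlongrightarrow> (\<Sum>k = 1..1. a k / b k)) F)"
    by (intro allI impI conjI ballI)
      (rule holder_quotient_eq_powr holder_quotient_1 holder_quotient_1_tendsto; assumption)+
qed

end
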